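(* Let $n\ge 2$ be an integer, let $G_n$ be the prime graph and $H_n$ the prime connection graph on the square free integers in $\{2,\dots,n\}$, and let $A_{H_n}$ be the adjacency matrix of $H_n$. Then for every vertex $x$, $$1-\chi_{G_n}(S(x)) = (1+A_{H_n})^{-1}_{xx},$$ where $S(x)$ is the unit sphere of $x$ in $G_n$ and $\chi_{G_n}(S(x))$ its Euler characteristic.
   Context: Both graphs have as vertex set the square free integers in $\{2,\dots,n\}$. In $G_n$, two distinct integers $a,b$ are adjacent if $a$ divides $b$ or $b$ divides $a$. In $H_n$, two distinct integers $a,b$ are adjacent if $\gcd(a,b)>1$. The unit sphere $S(x)$ of a vertex $x$ in a graph is the subgraph induced on the neighbors of $x$. The Euler characteristic of a finite simple graph is $\chi=\sum_{k\ge 0}(-1)^k v_k$, where $v_k$ is the number of complete subgraphs with $k+1$ vertices; the empty graph has $\chi=0$. The matrix $1+A_{H_n}$ (identity plus adjacency matrix) is invertible over $\mathbb{Z}$. *)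

theory Defs
  imports
    "HOL-Computational_Algebra.Squarefree"
    "Graph_Theory.Graph_Theory"
    "Jordan_Normal_Form.Matrix"
begin

text \<open>
  Finite simple graphs are those of Graph_Theory, i.e. loop-free symmetric digraphs without
  parallel arcs (locale \<^locale>\<open>graph\<close>, or \<^locale>\<open>pair_graph\<close> when arcs are
  pairs of vertices).
\<close>

definition squarefree_upto :: "nat \<Rightarrow> nat set" where
  "squarefree_upto n = {a \<in> {2..n}. squarefree a}"

definition prime_graph :: "nat \<Rightarrow> nat pair_pre_digraph" where
  "prime_graph n = \<lparr> pverts = squarefree_upto n,
     parcs = {(a, b). a \<in> squarefree_upto n \<and> b \<in> squarefree_upto n \<and> a \<noteq> b \<and>
                      (a dvd b \<or> b dvd a)} \<rparr>"

definition prime_connection_graph :: "nat \<Rightarrow> nat pair_pre_digraph" where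
  "prime_connection_graph n = \<lparr> pverts = squarefree_upto n,
     parcs = {(a, b). a \<in> squarefree_upto n \<and> b \<in> squarefree_upto n \<and> a \<noteq> b \<and>
                      gcd a b > 1} \<rparr>"

definition unit_sphere :: "('a, 'b) pre_digraph \<Rightarrow> 'a \<Rightarrow> ('a, 'b) pre_digraph" where
  "unit_sphere G x = G \<restriction> {y \<in> verts G. x \<rightarrow>\<^bsub>G\<^esub> y}"

text \<open>A complete subgraph of a simple graph is determined by its vertex set.\<close>

definition num_complete_subgraphs :: "('a, 'b) pre_digraph \<Rightarrow> nat \<Rightarrow> nat" where
  "num_complete_subgraphs G m = card {W. W \<subseteq> verts G \<and> complete_digraph m (G \<restriction> W)}"

text \<open>
  For a finite graph there are no complete subgraphs on more than \<open>card (verts G)\<close> vertices, so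
  truncating the sum over all \<open>k \<ge> 0\<close> loses nothing.
\<close>

definition euler_characteristic :: "('a, 'b) pre_digraph \<Rightarrow> int" where
  "euler_characteristic G =
     (\<Sum>k<card (verts G). (- 1) ^ k * int (num_complete_subgraphs G (k + 1)))"

text \<open>
  Rows and columns of matrices indexed by the vertices are numbered in increasing order of the
  vertices.
\<close>

definition vertex_list :: "('a :: linorder, 'b) pre_digraph \<Rightarrow> 'a list" where
  "vertex_list G = sorted_list_of_set (verts G)"

definition vertex_index :: "('a :: linorder, 'b) pre_digraph \<Rightarrow> 'a \<Rightarrow> nat" where
  "vertex_index G x = (THE i. i < length (vertex_list G) \<and> vertex_list G ! i = x)"

definition adjacency_matrix :: "('a :: linorder, 'b) pre_digraph \<Rightarrow> int mat" where
  "adjacency_matrix G = mat (card (verts G)) (card (verts G))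
     (\<lambda>(i, j). if vertex_list G ! i \<rightarrow>\<^bsub>G\<^esub> vertex_list G ! j then 1 else 0)"

text \<open>
  The two-sided inverse over the coefficient ring; meaningful for invertible matrices only.
\<close>

definition mat_inv :: "'a :: semiring_1 mat \<Rightarrow> 'a mat" where
  "mat_inv M = (THE B. inverts_mat M B \<and> inverts_mat B M)"

lemma finite_squarefree_upto [simp]: "finite (squarefree_upto n)"
  by (simp add: squarefree_upto_def)

lemma pair_graph_prime_graph: "pair_graph (prime_graph n)"
proof -
  have "finite (parcs (prime_graph n))"
    by (rule finite_subset[of _ "squarefree_upto n \<times> squarefree_upto n"])
       (auto simp: prime_graph_def)
  then show ?thesis
    by unfold_locales (auto simp: prime_graph_def symmetric_def sym_def)
qed

lemma pair_graph_prime_connection_graph: "pair_graph (prime_connection_graph n)"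
proof -
  have "finite (parcs (prime_connection_graph n))"
    by (rule finite_subset[of _ "squarefree_upto n \<times> squarefree_upto n"])
       (auto simp: prime_connection_graph_def)
  then show ?thesis
    by unfold_locales
       (auto simp: prime_connection_graph_def symmetric_def sym_def gcd.commute)
qed

lemma vertex_index:
  assumes "finite (verts G)" "x \<in> verts G"
  shows "vertex_index G x < card (verts G)" "vertex_list G ! vertex_index G x = x"
proof -
  have "\<exists>!i. i < length (vertex_list G) \<and> vertex_list G ! i = x"
    using assms by (intro distinct_Ex1) (auto simp: vertex_list_def)
  from theI'[OF this] show "vertex_index G x < card (verts G)" "vertex_list G ! vertex_index G x = x"
    by (auto simp: vertex_index_def vertex_list_def)
qed

lemma mat_inv_eqI:
  fixes M B :: "'a :: semiring_1 mat"
  assumes M: "M \<in> carrier_mat n n" and B: "inverts_mat M B" "inverts_mat B M"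
  shows "mat_inv M = B"
proof -
  have carrier: "C \<in> carrier_mat n n" if "inverts_mat M C" "inverts_mat C M" for C
  proof -
    have "dim_col (M * C) = n" "dim_col (C * M) = dim_row C"
      using that M by (auto simp: inverts_mat_def)
    then show ?thesis using M by auto
  qed
  have "C = B" if C: "inverts_mat M C" "inverts_mat C M" for C
  proof -
    have cs: "C \<in> carrier_mat n n" "B \<in> carrier_mat n n"
      using carrier C B by auto
    have "C = C * (M * B)" using B cs M by (simp add: inverts_mat_def)
    also have "\<dots> = (C * M) * B" using cs M by simp
    also have "\<dots> = B" using C cs M by (simp add: inverts_mat_def)
    finally show ?thesis .
  qed
  with B show ?thesis unfolding mat_inv_def by (blast intro: the_equality)
qed

end

theory Submission
  imports Defs
begin

text \<open>
  Let \<open>V\<close> be the vertex set and let \<open>\<mu>\<close> be the Moebius function. Since \<open>V \<union> {1}\<close> is closed under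
  divisors, \<open>[gcd a b > 1] = 1 - [gcd a b = 1] = - (\<Sum>d\<in>V. [d dvd a] [d dvd b] \<mu> d)\<close>. So
  \<open>1 + A = - Z\<^sup>T D Z\<close> with the zeta matrix \<open>Z\<close> of divisibility on \<open>V\<close> and \<open>D = diag \<mu>\<close>, whose entries
  are \<open>\<plusminus>1\<close>. Moebius inversion gives the inverse, with entries
  \<open>- \<mu> a \<mu> b (\<Sum>d\<in>V. [a dvd d] [b dvd d] \<mu> d)\<close>; at \<open>a = b = x\<close> this is minus the sum of \<open>\<mu>\<close> over
  the multiples of \<open>x\<close> in \<open>V\<close>.

  The complete subgraphs of \<open>S(x)\<close> are the chains for divisibility, and \<open>S(x)\<close> is the join of the
  proper divisors and the proper multiples of \<open>x\<close>. The quantity \<open>1 - \<chi>\<close> is multiplicative under joins,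
  and by Philip Hall's theorem it is \<open>- \<mu> x\<close> on the proper divisors and \<open>\<mu> x\<close> times the sum of \<open>\<mu>\<close>
  over the multiples of \<open>x\<close> in \<open>V\<close> on the proper multiples.
\<close>

section \<open>Moebius function on squarefree numbers\<close>

text \<open>This is the Moebius function on squarefree arguments only.\<close>

definition mobius_sign :: "nat \<Rightarrow> int" where
  "mobius_sign a = (- 1) ^ card (prime_factors a)"

lemma mobius_sign_square [simp]: "mobius_sign a * mobius_sign a = 1"
  by (simp add: mobius_sign_def flip: power_add)

lemma mobius_sign_square_mult [simp]: "mobius_sign a * (mobius_sign a * c) = c"
  by (simp flip: mult.assoc)

lemma mobius_sign_1 [simp]: "mobius_sign (Suc 0) = 1"
  by (simp add: mobius_sign_def)

lemma squarefree_prod_prime_factors: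
  fixes a :: nat
  assumes "squarefree a"
  shows "\<Prod>(prime_factors a) = a"
proof -
  have "a \<noteq> 0" using assms by (metis not_squarefree_0)
  then have "\<forall>p\<in>prime_factors a. multiplicity p a = 1"
    using assms squarefree_factorial_semiring' by blast
  then have "(\<Prod>p\<in>prime_factors a. p) = (\<Prod>p\<in>prime_factors a. p ^ multiplicity p a)"
    by (intro prod.cong) auto
  also have "\<dots> = a"
    using \<open>a \<noteq> 0\<close> prime_factorization_nat[of a] by simp
  finally show ?thesis .
qed

lemma squarefree_dvd_iff:
  fixes a b :: nat
  assumes "squarefree a" "squarefree b"
  shows "a dvd b \<longleftrightarrow> prime_factors a \<subseteq> prime_factors b"
proof
  assume "prime_factors a \<subseteq> prime_factors b"
  then have "\<Prod>(prime_factors a) dvd \<Prod>(prime_factors b)"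
    by (intro prod_dvd_prod_subset) auto
  then show "a dvd b" using assms by (simp add: squarefree_prod_prime_factors)
next
  assume "a dvd b"
  then show "prime_factors a \<subseteq> prime_factors b"
    using assms by (metis dvd_prime_factors not_squarefree_0)
qed

lemma prime_factors_prod_primes:
  fixes P :: "nat set"
  assumes "finite P" "\<And>p. p \<in> P \<Longrightarrow> prime p"
  shows "prime_factors (\<Prod>P) = P" "squarefree (\<Prod>P)"
proof -
  have "0 \<notin> P" using assms(2) by (metis not_prime_0)
  then show "prime_factors (\<Prod>P) = P"
    using assms by (subst prime_factors_prod) (auto simp: prime_prime_factors)
  show "squarefree (\<Prod>P)"
    using assms(2) by (intro squarefree_prod_coprime) (auto simp: primes_coprime squarefree_prime)
qed

text \<open>Taking prime factors turns the divisor interval from \<open>x\<close> to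
  \<open>t\<close> into the Boolean interval of sets between the two sets of primes. If it is
  proper, sets of even and of odd size are equally many in it and the signs cancel.\<close>

lemma sum_mobius_sign_interval:
  assumes t: "squarefree t"
  shows "(\<Sum>s | x dvd s \<and> s dvd t. mobius_sign s) = (if x = t then mobius_sign t else 0)"
proof (cases "x dvd t")
  case False
  then have "{s. x dvd s \<and> s dvd t} = {}" "x \<noteq> t" by (auto intro: dvd_trans)
  then show ?thesis by (simp only: sum.empty if_False)
next
  case True
  then have x: "squarefree x" using t squarefree_mono by blast
  show ?thesis
  proof (cases "x = t")
    case True
    then have "{s. x dvd s \<and> s dvd t} = {t}" by (auto dest: dvd_antisym)
    then show ?thesis using True by simp
  next
    case False
    let ?I = "{T. T \<subseteq> prime_factors t \<and> prime_factors x \<subseteq> T}"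
    have "(\<Sum>s | x dvd s \<and> s dvd t. mobius_sign s) = (\<Sum>T\<in>?I. (- 1) ^ card T)"
    proof (rule sum.reindex_bij_witness[of _ "\<lambda>T. \<Prod>T" prime_factors])
      fix s assume "s \<in> {s. x dvd s \<and> s dvd t}"
      then have s: "x dvd s" "s dvd t" "squarefree s" using t squarefree_mono by auto
      then show "\<Prod>(prime_factors s) = s" by (simp add: squarefree_prod_prime_factors)
      show "prime_factors s \<in> ?I" using s t x by (simp add: squarefree_dvd_iff)
      show "(- 1) ^ card (prime_factors s) = mobius_sign s" by (simp add: mobius_sign_def)
    next
      fix T assume T: "T \<in> ?I"
      then have fin: "finite T" by (auto intro: finite_subset)
      have pr: "\<And>p. p \<in> T \<Longrightarrow> prime p" using T by auto
      show "prime_factors (\<Prod>T) = T" using prime_factors_prod_primes[OF fin pr] by simp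
      show "\<Prod>T \<in> {s. x dvd s \<and> s dvd t}"
        using prime_factors_prod_primes[OF fin pr] T x t by (simp add: squarefree_dvd_iff)
    qed
    also have "\<dots> = 0"
    proof (rule sum_alternating_cancels)
      have "prime_factors x \<subset> prime_factors t"
        using False \<open>x dvd t\<close> x t squarefree_dvd_iff[OF x t] squarefree_prod_prime_factors
        by (metis psubsetI)
      from card_subsupersets_even_odd[OF _ this]
      show "card {T \<in> ?I. even (card T)} = card {T \<in> ?I. odd (card T)}"
        by simp
    qed simp
    finally show ?thesis using False by simp
  qed
qed

section \<open>Signed chain counts and Philip Hall's theorem\<close>

definition divisor_chains :: "nat set \<Rightarrow> nat set set" where
  "divisor_chains S = {W. W \<subseteq> S \<and> (\<forall>a\<in>W. \<forall>b\<in>W. a dvd b \<or> b dvd a)}"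

text \<open>The empty chain contributes 1, so this is \<open>1 - \<chi>\<close> of the complex of nonempty chains.\<close>

definition chain_sum :: "nat set \<Rightarrow> int" where
  "chain_sum S = (\<Sum>W\<in>divisor_chains S. (- 1) ^ card W)"

lemma finite_divisor_chains [simp]: "finite S \<Longrightarrow> finite (divisor_chains S)"
  by (simp add: divisor_chains_def)

lemma finite_divisor_chain: "finite S \<Longrightarrow> W \<in> divisor_chains S \<Longrightarrow> finite W"
  by (auto simp: divisor_chains_def intro: finite_subset)

text \<open>A nonempty chain of positive numbers has its numerical maximum \<open>t\<close> as
  greatest element for divisibility. Deleting \<open>t\<close> leaves an arbitrary chain of proper
  divisors of \<open>t\<close> in \<open>S\<close> and flips the sign; the leading 1 is the empty
  chain.\<close>

lemma chain_sum_by_Max: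
  assumes fin: "finite S" and nz: "0 \<notin> S"
  shows "chain_sum S = 1 - (\<Sum>t\<in>S. chain_sum {s \<in> S. s dvd t \<and> s \<noteq> t})"
proof -
  let ?C = "divisor_chains S - {{}}"
  let ?B = "\<lambda>t. {s \<in> S. s dvd t \<and> s \<noteq> t}"
  have top: "(\<Sum>W | W \<in> ?C \<and> Max W = t. (- 1) ^ card W) = - chain_sum (?B t)" if t: "t \<in> S" for t
  proof -
    have "(\<Sum>W | W \<in> ?C \<and> Max W = t. (- 1) ^ card W) =
        (\<Sum>W\<in>divisor_chains (?B t). - ((- 1 :: int) ^ card W))"
    proof (rule sum.reindex_bij_witness[of _ "insert t" "\<lambda>W. W - {t}"])
      fix W assume W: "W \<in> {W \<in> ?C. Max W = t}"
      then have finW: "finite W" using fin finite_divisor_chain by auto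
      then have W': "t \<in> W" "W \<subseteq> S" "\<And>a. a \<in> W \<Longrightarrow> a \<le> t"
        using W Max_in[of W] by (auto simp: divisor_chains_def)
      have "a dvd t" if "a \<in> W" for a
      proof -
        \<comment> \<open>In the case \<open>t dvd a\<close>, positivity of \<open>a\<close> gives
          \<open>t \<le> a\<close>, so maximality of \<open>t\<close> forces
          \<open>a = t\<close>.\<close>
        have "a dvd t \<or> t dvd a" using that W W' by (auto simp: divisor_chains_def)
        moreover have "a > 0" using that W' nz by (metis gr0I subsetD)
        ultimately show ?thesis using W'(3)[OF that] by (metis dvd_imp_le le_antisym)
      qed
      then show "W - {t} \<in> divisor_chains (?B t)"
        using W by (auto simp: divisor_chains_def)
      show "insert t (W - {t}) = W" using W' by auto
      show "- ((- 1 :: int) ^ card (W - {t})) = (- 1) ^ card W"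
        by (simp flip: card_Suc_Diff1[OF finW W'(1)])
    next
      fix W assume W: "W \<in> divisor_chains (?B t)"
      then show "insert t W - {t} = W" by (auto simp: divisor_chains_def)
      have finW: "finite W" using W fin by (auto intro: finite_divisor_chain[of "?B t"])
      have "a \<le> t" if "a \<in> W" for a
        using W that t nz by (intro dvd_imp_le) (auto simp: divisor_chains_def intro: gr0I)
      then have "Max (insert t W) = t" using finW by (intro Max_eqI) auto
      then show "insert t W \<in> {W \<in> ?C. Max W = t}"
        using W t by (auto simp: divisor_chains_def)
    qed
    then show ?thesis by (simp add: chain_sum_def sum_negf)
  qed
  have img: "Max ` ?C \<subseteq> S"
  proof (rule image_subsetI)
    fix W assume W: "W \<in> ?C"
    then have "Max W \<in> W" using fin finite_divisor_chain by (intro Max_in) auto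
    then show "Max W \<in> S" using W by (auto simp: divisor_chains_def)
  qed
  have "chain_sum S = 1 + (\<Sum>W\<in>?C. (- 1) ^ card W)"
    unfolding chain_sum_def using fin
    by (subst sum.remove[of _ "{}"]) (auto simp: divisor_chains_def)
  also have "(\<Sum>W\<in>?C. (- 1) ^ card W) = (\<Sum>t\<in>S. \<Sum>W | W \<in> ?C \<and> Max W = t. (- 1 :: int) ^ card W)"
    using fin img by (intro sum.group[symmetric]) auto
  also have "\<dots> = (\<Sum>t\<in>S. - chain_sum (?B t))"
    using top by (intro sum.cong) auto
  finally show ?thesis by (simp add: sum_negf)
qed

text \<open>A chain in the union splits uniquely into its traces on \<open>A\<close> and
  \<open>B\<close>, and by \<open>dvd\<close> any two chains, one from each side, unite to a chain;
  sizes add, so signs multiply.\<close>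

lemma chain_sum_join:
  assumes fin: "finite A" "finite B" and disj: "A \<inter> B = {}"
    and dvd: "\<And>a b. a \<in> A \<Longrightarrow> b \<in> B \<Longrightarrow> a dvd b"
  shows "chain_sum (A \<union> B) = chain_sum A * chain_sum B"
proof -
  have "chain_sum A * chain_sum B =
      (\<Sum>(X, Y)\<in>divisor_chains A \<times> divisor_chains B. (- 1) ^ card X * (- 1) ^ card Y)"
    by (simp add: chain_sum_def sum_product sum.cartesian_product)
  also have "\<dots> = chain_sum (A \<union> B)"
    unfolding chain_sum_def
  proof (rule sum.reindex_bij_witness[of _ "\<lambda>W. (W \<inter> A, W \<inter> B)" "\<lambda>(X, Y). X \<union> Y"])
    fix P assume P: "P \<in> divisor_chains A \<times> divisor_chains B"
    obtain X Y where XY: "P = (X, Y)" "X \<in> divisor_chains A" "Y \<in> divisor_chains B"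
      using P by auto
    then have sub: "X \<subseteq> A" "Y \<subseteq> B" by (auto simp: divisor_chains_def)
    have "finite X" "finite Y" "X \<inter> Y = {}"
      using sub fin disj by (auto intro: finite_subset)
    then show "(- 1) ^ card (case P of (X, Y) \<Rightarrow> X \<union> Y) =
        (case P of (X, Y) \<Rightarrow> (- 1 :: int) ^ card X * (- 1) ^ card Y)"
      by (simp add: XY card_Un_disjoint power_add)
    show "((case P of (X, Y) \<Rightarrow> X \<union> Y) \<inter> A, (case P of (X, Y) \<Rightarrow> X \<union> Y) \<inter> B) = P"
      using sub disj by (auto simp: XY)
    have "a dvd b \<or> b dvd a" if "a \<in> X \<union> Y" "b \<in> X \<union> Y" for a b
      using that XY(2,3) dvd[of a b] dvd[of b a] sub by (auto simp: divisor_chains_def)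
    then show "(case P of (X, Y) \<Rightarrow> X \<union> Y) \<in> divisor_chains (A \<union> B)"
      using sub by (auto simp: XY(1) divisor_chains_def)
  qed (auto simp: divisor_chains_def)
  finally show ?thesis by simp
qed

text \<open>This is Hall's theorem for an open interval: the value is minus the Moebius function of
  \<open>t / x\<close>, which factors as \<open>mobius_sign x * mobius_sign t\<close> because
  \<open>t\<close> is squarefree. Splitting chains by their maximum reduces it to smaller upper
  ends.\<close>

lemma chain_sum_interval:
  assumes "squarefree t" "x dvd t" "x \<noteq> t"
  shows "chain_sum {s. x dvd s \<and> s dvd t \<and> s \<noteq> x \<and> s \<noteq> t} = - mobius_sign x * mobius_sign t"
  using assms
proof (induction t rule: less_induct)
  case (less t)
  let ?I = "{s. x dvd s \<and> s dvd t \<and> s \<noteq> x \<and> s \<noteq> t}"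
  have t0: "t > 0" using less.prems by (auto intro: gr0I)
  have fin: "finite {s. x dvd s \<and> s dvd t}"
    by (rule finite_subset[of _ "{..t}"]) (use t0 in \<open>auto dest: dvd_imp_le\<close>)
  have finI: "finite ?I" by (rule finite_subset[OF _ fin]) auto
  have "chain_sum ?I = 1 - (\<Sum>u\<in>?I. chain_sum {s \<in> ?I. s dvd u \<and> s \<noteq> u})"
    using t0 by (intro chain_sum_by_Max finI) auto
  also have "(\<Sum>u\<in>?I. chain_sum {s \<in> ?I. s dvd u \<and> s \<noteq> u}) = (\<Sum>u\<in>?I. - mobius_sign x * mobius_sign u)"
  proof (rule sum.cong[OF refl])
    fix u assume u: "u \<in> ?I"
    then have "u < t" using t0 by (auto dest: dvd_imp_le)
    have "{s \<in> ?I. s dvd u \<and> s \<noteq> u} = {s. x dvd s \<and> s dvd u \<and> s \<noteq> x \<and> s \<noteq> u}"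
      using u by (auto intro: dvd_trans dest: dvd_antisym)
    then show "chain_sum {s \<in> ?I. s dvd u \<and> s \<noteq> u} = - mobius_sign x * mobius_sign u"
      using less.IH[OF \<open>u < t\<close>] u less.prems by (auto intro: squarefree_mono)
  qed
  also have "\<dots> = - mobius_sign x * (\<Sum>u\<in>?I. mobius_sign u)"
    by (simp add: sum_distrib_left sum_negf)
  \<comment> \<open>The sum over the closed interval vanishes since \<open>x \<noteq> t\<close>, so
    the open interval contributes minus the two endpoints.\<close>
  also have "(\<Sum>u\<in>?I. mobius_sign u) = - mobius_sign x - mobius_sign t"
  proof -
    have eq: "{s. x dvd s \<and> s dvd t} = insert x (insert t ?I)" using less.prems by auto
    have "(\<Sum>s | x dvd s \<and> s dvd t. mobius_sign s) = mobius_sign x + (mobius_sign t + (\<Sum>u\<in>?I. mobius_sign u))"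
      unfolding eq using finI less.prems by simp
    then show ?thesis using sum_mobius_sign_interval[of t x] less.prems by simp
  qed
  finally show ?case by (simp add: algebra_simps)
qed

section \<open>Chains in the unit sphere\<close>

lemma squarefree_upto_dvd:
  "a dvd b \<Longrightarrow> b \<in> squarefree_upto n \<Longrightarrow> a \<noteq> 1 \<Longrightarrow> a \<in> squarefree_upto n"
proof -
  assume a: "a dvd b" "b \<in> squarefree_upto n" "a \<noteq> 1"
  then have "a \<le> b" "a \<noteq> 0" by (auto simp: squarefree_upto_def intro: dvd_imp_le intro!: gr0I)
  then show ?thesis using a squarefree_mono[of a b] by (auto simp: squarefree_upto_def)
qed

lemma chain_sum_sphere:
  assumes x: "x \<in> squarefree_upto n"
  shows "chain_sum {y \<in> squarefree_upto n. x \<noteq> y \<and> (x dvd y \<or> y dvd x)} =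
    - (\<Sum>d | d \<in> squarefree_upto n \<and> x dvd d. mobius_sign d)"
proof -
  let ?V = "squarefree_upto n"
  \<comment> \<open>The proper divisors of \<open>x\<close> are phrased as the open interval from 1
    to \<open>x\<close>, to match \<open>chain_sum_interval\<close>.\<close>
  let ?A = "{s. 1 dvd s \<and> s dvd x \<and> s \<noteq> 1 \<and> s \<noteq> x}"
  let ?B = "{y \<in> ?V. x dvd y \<and> x \<noteq> y}"
  have sqf: "squarefree y" "y \<noteq> 1" "y \<noteq> 0" if "y \<in> ?V" for y
    using that by (auto simp: squarefree_upto_def)
  have A: "?A = {y \<in> ?V. y dvd x \<and> y \<noteq> x}"
    using squarefree_upto_dvd[OF _ x] sqf by auto
  have chA: "chain_sum ?A = - mobius_sign x"
    using sqf[OF x] by (subst chain_sum_interval) auto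
  have "chain_sum ?B = 1 - (\<Sum>t\<in>?B. chain_sum {s \<in> ?B. s dvd t \<and> s \<noteq> t})"
    using sqf by (intro chain_sum_by_Max) auto
  also have "(\<Sum>t\<in>?B. chain_sum {s \<in> ?B. s dvd t \<and> s \<noteq> t}) = (\<Sum>t\<in>?B. - mobius_sign x * mobius_sign t)"
  proof (rule sum.cong[OF refl])
    fix t assume t: "t \<in> ?B"
    \<comment> \<open>An \<open>s\<close> between \<open>x\<close> and \<open>t\<close> is a
      multiple of \<open>x \<noteq> 1\<close>, hence differs from 1 and lies in \<open>?V\<close>:
      below \<open>t\<close>, the truncation at \<open>n\<close> is invisible.\<close>
    have "{s \<in> ?B. s dvd t \<and> s \<noteq> t} = {s. x dvd s \<and> s dvd t \<and> s \<noteq> x \<and> s \<noteq> t}"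
      using t sqf[OF x] squarefree_upto_dvd[of _ t n] by auto
    then show "chain_sum {s \<in> ?B. s dvd t \<and> s \<noteq> t} = - mobius_sign x * mobius_sign t"
      using chain_sum_interval[of t x] t sqf by auto
  qed
  also have "\<dots> = - mobius_sign x * (\<Sum>t\<in>?B. mobius_sign t)"
    by (simp add: sum_distrib_left sum_negf)
  finally have chB: "chain_sum ?B = 1 + mobius_sign x * (\<Sum>t\<in>?B. mobius_sign t)" by simp
  have "{y \<in> ?V. x \<noteq> y \<and> (x dvd y \<or> y dvd x)} = ?A \<union> ?B" unfolding A by auto
  then have "chain_sum {y \<in> ?V. x \<noteq> y \<and> (x dvd y \<or> y dvd x)} = chain_sum (?A \<union> ?B)"
    by (rule arg_cong)
  also have "\<dots> = chain_sum ?A * chain_sum ?B"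
    unfolding A by (rule chain_sum_join) (auto intro: dvd_trans dest: dvd_antisym)
  also have "\<dots> = - (mobius_sign x + (\<Sum>t\<in>?B. mobius_sign t))"
    unfolding chA chB by (simp add: algebra_simps)
  also have "mobius_sign x + (\<Sum>t\<in>?B. mobius_sign t) = (\<Sum>d\<in>insert x ?B. mobius_sign d)"
    by simp
  also have "insert x ?B = {d. d \<in> ?V \<and> x dvd d}" using x by auto
  finally show ?thesis .
qed


section \<open>Inverting the gcd kernel\<close>

lemma sum_mobius_sign_squarefree_upto_interval:
  assumes "c \<in> squarefree_upto n" "d \<in> squarefree_upto n"
  shows "(\<Sum>y\<in>squarefree_upto n. of_bool (c dvd y \<and> y dvd d) * mobius_sign y) =
    of_bool (c = d) * mobius_sign d"
proof -
  have "{y \<in> squarefree_upto n. c dvd y \<and> y dvd d} = {y. c dvd y \<and> y dvd d}"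
    using assms squarefree_upto_dvd[of _ d n] by (auto simp: squarefree_upto_def)
  then show ?thesis
    using sum_mobius_sign_interval[of d c] assms
    by (simp add: squarefree_upto_def of_bool_def if_distrib[of "\<lambda>z. z * _"] flip: sum.inter_filter cong: if_cong)
qed

text \<open>Common divisors are the divisors of the gcd, over which the Moebius sum detects gcd 1.
  The divisor 1 lies outside the vertex set and contributes the missing 1.\<close>

lemma gcd_gt_1_eq_sum:
  assumes "a \<in> squarefree_upto n" "b \<in> squarefree_upto n"
  shows "of_bool (gcd a b > 1) =
    - (\<Sum>c\<in>squarefree_upto n. of_bool (c dvd a \<and> c dvd b) * mobius_sign c)"
proof -
  let ?I = "{c \<in> squarefree_upto n. c dvd a \<and> c dvd b}"
  define g where "g = gcd a b"
  have g: "squarefree g" "g \<noteq> 0"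
    using assms squarefree_mono[of g a] by (auto simp: g_def squarefree_upto_def)
  have "{c. 1 dvd c \<and> c dvd g} = insert 1 ?I"
    using squarefree_upto_dvd[OF _ assms(1)] by (auto simp: g_def)
  moreover have "1 \<notin> ?I" by (simp add: squarefree_upto_def)
  ultimately have "(\<Sum>c | 1 dvd c \<and> c dvd g. mobius_sign c) = 1 + (\<Sum>c\<in>?I. mobius_sign c)"
    by simp
  then have "1 + (\<Sum>c\<in>?I. mobius_sign c) = of_bool (g = 1)"
    using sum_mobius_sign_interval[OF g(1), of 1] by (cases "g = 1") simp_all
  moreover have "(\<Sum>c\<in>?I. mobius_sign c) =
      (\<Sum>c\<in>squarefree_upto n. of_bool (c dvd a \<and> c dvd b) * mobius_sign c)"
    by (simp add: Int_def)
  moreover have "of_bool (g > 1) = 1 - (of_bool (g = 1) :: int)" using g(2) by auto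
  ultimately show ?thesis unfolding g_def by linarith
qed

text \<open>For \<open>a\<close> dividing a squarefree \<open>d\<close>, the inverse zeta entry is
  \<open>mobius_sign a * mobius_sign d\<close>. Two such factors and the diagonal entry
  \<open>mobius_sign d\<close> leave a single \<open>mobius_sign d\<close>.\<close>

definition inverse_entry :: "nat \<Rightarrow> nat \<Rightarrow> nat \<Rightarrow> int" where
  "inverse_entry n a b = - (mobius_sign a * mobius_sign b *
     (\<Sum>d\<in>squarefree_upto n. of_bool (a dvd d \<and> b dvd d) * mobius_sign d))"

lemma inverse_entry_commute: "inverse_entry n a b = inverse_entry n b a"
  by (simp add: inverse_entry_def conj_commute mult.commute)

text \<open>With both factors expanded as sums over \<open>c\<close> and \<open>d\<close>, summing
  over \<open>y\<close> first forces \<open>c = d\<close> by Moebius inversion. What remains is the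
  Moebius sum over the interval from \<open>b\<close> to \<open>a\<close>.\<close>

lemma sum_gcd_inverse_entry:
  assumes a: "a \<in> squarefree_upto n" and b: "b \<in> squarefree_upto n"
  shows "(\<Sum>y\<in>squarefree_upto n. of_bool (gcd a y > 1) * inverse_entry n y b) = of_bool (a = b)"
proof -
  let ?V = "squarefree_upto n" and ?s = mobius_sign
  have "(\<Sum>y\<in>?V. of_bool (gcd a y > 1) * inverse_entry n y b) =
      (\<Sum>y\<in>?V. (\<Sum>c\<in>?V. of_bool (c dvd a \<and> c dvd y) * ?s c) *
        (\<Sum>d\<in>?V. ?s y * ?s b * (of_bool (y dvd d \<and> b dvd d) * ?s d)))"
    using gcd_gt_1_eq_sum[OF a] by (intro sum.cong) (simp_all add: inverse_entry_def flip: sum_distrib_left)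
  also have "\<dots> = (\<Sum>y\<in>?V. \<Sum>c\<in>?V. \<Sum>d\<in>?V.
      of_bool (c dvd a) * of_bool (b dvd d) * ?s b * ?s c * ?s d * (of_bool (c dvd y \<and> y dvd d) * ?s y))"
    unfolding sum_product by (intro sum.cong refl) (simp add: of_bool_conj mult_ac)
  also have "\<dots> = (\<Sum>c\<in>?V. \<Sum>y\<in>?V. \<Sum>d\<in>?V.
      of_bool (c dvd a) * of_bool (b dvd d) * ?s b * ?s c * ?s d * (of_bool (c dvd y \<and> y dvd d) * ?s y))"
    by (rule sum.swap)
  also have "\<dots> = (\<Sum>c\<in>?V. \<Sum>d\<in>?V. \<Sum>y\<in>?V.
      of_bool (c dvd a) * of_bool (b dvd d) * ?s b * ?s c * ?s d * (of_bool (c dvd y \<and> y dvd d) * ?s y))"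
    by (rule sum.cong[OF refl], rule sum.swap)
  also have "\<dots> = (\<Sum>c\<in>?V. \<Sum>d\<in>?V.
      of_bool (c dvd a) * of_bool (b dvd d) * ?s b * ?s c * ?s d * (of_bool (c = d) * ?s d))"
    by (intro sum.cong refl)
       (simp only: sum_mobius_sign_squarefree_upto_interval sum_distrib_left[symmetric])
  also have "\<dots> = (\<Sum>c\<in>?V. \<Sum>d\<in>?V. if c = d then
      of_bool (c dvd a) * of_bool (b dvd c) * ?s b * ?s c else 0)"
    by (intro sum.cong refl) (simp add: mult.assoc)
  also have "\<dots> = (\<Sum>c\<in>?V. ?s b * (of_bool (b dvd c \<and> c dvd a) * ?s c))"
    by (intro sum.cong refl) (simp add: of_bool_conj mult_ac)
  also have "\<dots> = of_bool (a = b)"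
    using sum_mobius_sign_squarefree_upto_interval[OF b a]
    by (auto simp flip: sum_distrib_left)
  finally show ?thesis .
qed

section \<open>Euler characteristic as a signed clique count\<close>

lemma graph_induce_subgraph:
  assumes "graph G" "W \<subseteq> verts G"
  shows "graph (G \<restriction> W)"
proof -
  interpret graph G by fact
  have ind: "induced_subgraph (G \<restriction> W) G" using assms(2) by (rule induced_induce)
  then show ?thesis
    using digraphI_induced[OF ind] induced_graph_imp_symmetric[OF sym_arcs ind]
    by (intro digraph.graphI)
qed

lemma complete_digraph_induce_subgraph_iff:
  assumes "graph G"
  shows "complete_digraph m (G \<restriction> W) \<and> W \<subseteq> verts G \<longleftrightarrow>
    W \<subseteq> verts G \<and> (\<forall>u\<in>W. \<forall>v\<in>W. u \<noteq> v \<longrightarrow> u \<rightarrow>\<^bsub>G\<^esub> v) \<and> card W = m"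
proof (cases "W \<subseteq> verts G")
  case True
  interpret graph G by fact
  have "graph (G \<restriction> W)" using assms True by (rule graph_induce_subgraph)
  moreover have "arcs_ends (G \<restriction> W) = {(u, v). u \<in> W \<and> v \<in> W \<and> u \<rightarrow>\<^bsub>G\<^esub> v}"
    by (auto simp: arcs_ends_conv)
  ultimately show ?thesis
    using True adj_not_same by (auto simp: complete_digraph_def set_eq_iff)
qed auto

lemma one_minus_euler_characteristic:
  assumes "graph G"
  shows "1 - euler_characteristic G =
    (\<Sum>W | W \<subseteq> verts G \<and> (\<forall>u\<in>W. \<forall>v\<in>W. u \<noteq> v \<longrightarrow> u \<rightarrow>\<^bsub>G\<^esub> v). (- 1) ^ card W)"
proof -
  interpret graph G by fact
  let ?C = "{W. W \<subseteq> verts G \<and> (\<forall>u\<in>W. \<forall>v\<in>W. u \<noteq> v \<longrightarrow> u \<rightarrow>\<^bsub>G\<^esub> v)}"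
  have num: "num_complete_subgraphs G m = card {W \<in> ?C. card W = m}" for m
    unfolding num_complete_subgraphs_def
    using complete_digraph_induce_subgraph_iff[OF assms, of m]
    by (intro arg_cong[of _ _ card]) auto
  \<comment> \<open>Infinite sets also have \<open>card\<close> 0; finiteness of the vertex set
    excludes them.\<close>
  have "{W \<in> ?C. card W = 0} = {{}}"
    using finite_verts by (auto dest: finite_subset)
  then have num0: "num_complete_subgraphs G 0 = 1"
    unfolding num by simp
  have "(\<Sum>W\<in>?C. (- 1 :: int) ^ card W) =
      (\<Sum>m\<le>card (verts G). \<Sum>W | W \<in> ?C \<and> card W = m. (- 1) ^ card W)"
    using finite_verts by (intro sum.group[symmetric]) (auto intro: card_mono)
  also have "\<dots> = (\<Sum>m\<le>card (verts G). (- 1) ^ m * int (num_complete_subgraphs G m))"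
    unfolding num by (intro sum.cong refl) (simp add: mult.commute)
  \<comment> \<open>The empty clique gives the 1. Cliques on \<open>Suc k\<close> vertices have
    dimension \<open>k\<close>, and this shift turns the rest into minus the Euler
    characteristic.\<close>
  also have "\<dots> = 1 + (\<Sum>k<card (verts G). (- 1) ^ Suc k * int (num_complete_subgraphs G (Suc k)))"
    by (simp add: lessThan_Suc_atMost[symmetric] sum.lessThan_Suc_shift num0 del: sum.lessThan_Suc)
  finally show ?thesis by (simp add: euler_characteristic_def sum_negf)
qed

lemma one_minus_euler_characteristic_unit_sphere:
  assumes x: "x \<in> squarefree_upto n"
  shows "1 - euler_characteristic (unit_sphere (prime_graph n) x) =
    chain_sum {y \<in> squarefree_upto n. x \<noteq> y \<and> (x dvd y \<or> y dvd x)}"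
proof -
  interpret pair_graph "prime_graph n" by (rule pair_graph_prime_graph)
  let ?S = "{y \<in> squarefree_upto n. x \<noteq> y \<and> (x dvd y \<or> y dvd x)}"
  have S: "{y \<in> verts (prime_graph n). x \<rightarrow>\<^bsub>prime_graph n\<^esub> y} = ?S"
    using x by (auto simp: prime_graph_def)
  have sub: "?S \<subseteq> verts (prime_graph n)" by (auto simp: prime_graph_def)
  have "graph (prime_graph n)" by unfold_locales
  then have gr: "graph (prime_graph n \<restriction> ?S)" using sub by (rule graph_induce_subgraph)
  have ends: "u \<rightarrow>\<^bsub>with_proj (prime_graph n) \<restriction> ?S\<^esub> v \<longleftrightarrow> u \<noteq> v \<and> (u dvd v \<or> v dvd u)"
    if "u \<in> ?S" "v \<in> ?S" for u v
    using that unfolding arcs_ends_conv by (force simp: prime_graph_def)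
  have "{W. W \<subseteq> ?S \<and> (\<forall>u\<in>W. \<forall>v\<in>W. u \<noteq> v \<longrightarrow> u \<rightarrow>\<^bsub>with_proj (prime_graph n) \<restriction> ?S\<^esub> v)} =
      divisor_chains ?S"
    unfolding divisor_chains_def
  proof (intro Collect_cong conj_cong refl ball_cong)
    fix W u v assume "W \<subseteq> ?S" "u \<in> W" "v \<in> W"
    then show "(u \<noteq> v \<longrightarrow> u \<rightarrow>\<^bsub>with_proj (prime_graph n) \<restriction> ?S\<^esub> v) \<longleftrightarrow> u dvd v \<or> v dvd u"
      using ends[of u v] by (cases "u = v") auto
  qed
  then show ?thesis
    unfolding unit_sphere_def S one_minus_euler_characteristic[OF gr] chain_sum_def by simp
qed

section \<open>Matrices of kernels on a finite set, and the final identity\<close>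

text \<open>The order of rows and columns is that of \<open>vertex_list\<close>, so matrix
  identities reduce to sums over \<open>V\<close> without indices.\<close>

definition kernel_matrix :: "'a :: linorder set \<Rightarrow> ('a \<Rightarrow> 'a \<Rightarrow> int) \<Rightarrow> int mat" where
  "kernel_matrix V f = mat (card V) (card V)
     (\<lambda>(i, j). f (sorted_list_of_set V ! i) (sorted_list_of_set V ! j))"

lemma kernel_matrix_mult:
  assumes "finite V"
  shows "kernel_matrix V f * kernel_matrix V g = kernel_matrix V (\<lambda>a b. \<Sum>c\<in>V. f a c * g c b)"
proof (rule eq_matI)
  let ?l = "sorted_list_of_set V"
  have bij: "bij_betw ((!) ?l) {0..<card V} V"
    using assms by (intro bij_betw_nth) auto
  fix i j assume "i < dim_row (kernel_matrix V (\<lambda>a b. \<Sum>c\<in>V. f a c * g c b))"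
    "j < dim_col (kernel_matrix V (\<lambda>a b. \<Sum>c\<in>V. f a c * g c b))"
  then show "(kernel_matrix V f * kernel_matrix V g) $$ (i, j) =
      kernel_matrix V (\<lambda>a b. \<Sum>c\<in>V. f a c * g c b) $$ (i, j)"
    by (simp add: kernel_matrix_def scalar_prod_def flip: sum.reindex_bij_betw[OF bij])
qed (simp_all add: kernel_matrix_def)

lemma kernel_matrix_cong:
  assumes "finite V" "\<And>a b. a \<in> V \<Longrightarrow> b \<in> V \<Longrightarrow> f a b = g a b"
  shows "kernel_matrix V f = kernel_matrix V g"
  unfolding kernel_matrix_def
  using assms nth_mem[of _ "sorted_list_of_set V"] by (intro cong_mat) auto

lemma kernel_matrix_of_bool_eq:
  assumes "finite V"
  shows "kernel_matrix V (\<lambda>a b. of_bool (a = b)) = 1\<^sub>m (card V)"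
  unfolding kernel_matrix_def one_mat_def
  using assms by (intro cong_mat) (auto simp: nth_eq_iff_index_eq)

theorem corollary2:
  fixes n :: nat
  assumes "n \<ge> 2"
  shows "let M = 1\<^sub>m (card (verts (prime_connection_graph n)))
                 + adjacency_matrix (prime_connection_graph n)
         in invertible_mat M \<and>
            (\<forall>x \<in> verts (prime_graph n).
               1 - euler_characteristic (unit_sphere (prime_graph n) x) =
               mat_inv M $$ (vertex_index (prime_connection_graph n) x,
                             vertex_index (prime_connection_graph n) x))"
proof -
  let ?V = "squarefree_upto n" and ?H = "prime_connection_graph n"
  define M where "M = 1\<^sub>m (card (verts ?H)) + adjacency_matrix ?H"
  define L :: "nat \<Rightarrow> nat \<Rightarrow> int" where "L a b = of_bool (gcd a b > 1)" for a b
  define B where "B = kernel_matrix ?V (inverse_entry n)"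
  have verts: "pverts (prime_graph n) = ?V" "pverts ?H = ?V"
    by (simp_all add: prime_graph_def prime_connection_graph_def)
  have M: "M = kernel_matrix ?V L"
  proof (rule eq_matI)
    fix i j assume "i < dim_row (kernel_matrix ?V L)" "j < dim_col (kernel_matrix ?V L)"
    then have ij: "i < card ?V" "j < card ?V" by (simp_all add: kernel_matrix_def)
    let ?l = "sorted_list_of_set ?V"
    have mem: "?l ! i \<in> ?V" "?l ! j \<in> ?V"
      using ij nth_mem[of i ?l] nth_mem[of j ?l] by auto
    have eq: "?l ! i = ?l ! j \<longleftrightarrow> i = j" using ij by (simp add: nth_eq_iff_index_eq)
    \<comment> \<open>On the diagonal \<open>gcd a a = a > 1\<close>, so \<open>L\<close> already
      contains the identity matrix.\<close>
    have "?l ! j > 1" using mem by (simp add: squarefree_upto_def)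
    with mem eq ij show "M $$ (i, j) = kernel_matrix ?V L $$ (i, j)"
      by (auto simp: M_def verts adjacency_matrix_def vertex_list_def kernel_matrix_def L_def
            prime_connection_graph_def)
  qed (simp_all add: M_def kernel_matrix_def adjacency_matrix_def prime_connection_graph_def)
  have "M * B = 1\<^sub>m (card ?V)"
    unfolding M B_def kernel_matrix_mult[OF finite_squarefree_upto]
      kernel_matrix_of_bool_eq[OF finite_squarefree_upto, symmetric]
    by (intro kernel_matrix_cong) (simp_all only: L_def sum_gcd_inverse_entry finite_squarefree_upto)
  moreover have "B * M = 1\<^sub>m (card ?V)"
  proof -
    \<comment> \<open>Both kernels are symmetric, so this is the previous product with
      \<open>a\<close> and \<open>b\<close> exchanged.\<close>
    have "(\<Sum>c\<in>?V. inverse_entry n a c * L c b) = of_bool (a = b)" if "a \<in> ?V" "b \<in> ?V" for a b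
      using sum_gcd_inverse_entry[OF that(2,1)]
      by (simp add: L_def mult.commute gcd.commute inverse_entry_commute[of n a] eq_commute[of a b])
    then show ?thesis
      unfolding M B_def kernel_matrix_mult[OF finite_squarefree_upto]
        kernel_matrix_of_bool_eq[OF finite_squarefree_upto, symmetric]
      by (intro kernel_matrix_cong) simp_all
  qed
  ultimately have inv: "inverts_mat M B" "inverts_mat B M"
    by (simp_all add: inverts_mat_def M B_def kernel_matrix_def)
  have carrier: "M \<in> carrier_mat (card ?V) (card ?V)" by (simp add: M kernel_matrix_def)
  have "invertible_mat M"
    using inv carrier by (auto simp: invertible_mat_def)
  moreover have "1 - euler_characteristic (unit_sphere (prime_graph n) x) =
      mat_inv M $$ (vertex_index ?H x, vertex_index ?H x)" if x: "x \<in> ?V" for x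
  proof -
    let ?i = "vertex_index ?H x"
    have "?i < card ?V" "sorted_list_of_set ?V ! ?i = x"
      using vertex_index[of ?H x] x by (simp_all add: verts vertex_list_def)
    then have "mat_inv M $$ (?i, ?i) = inverse_entry n x x"
      by (simp add: mat_inv_eqI[OF carrier inv] B_def kernel_matrix_def)
    also have "\<dots> = - (\<Sum>d | d \<in> ?V \<and> x dvd d. mobius_sign d)"
      by (simp add: inverse_entry_def Int_def)
    also have "\<dots> = 1 - euler_characteristic (unit_sphere (prime_graph n) x)"
      by (simp add: one_minus_euler_characteristic_unit_sphere[OF x] chain_sum_sphere[OF x])
    finally show ?thesis by simp
  qed
  ultimately show ?thesis unfolding Let_def M_def[symmetric] by (simp add: verts)
qed

end
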